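(* For all $m=0,1,\ldots$ and $0<\xi<\infty$, $$\frac1\pi\int_0^\infty\frac{e^{-\eta}L_m^{-1/2}(\eta)\,d\eta}{(\eta-\xi)\sqrt\eta}=-\frac{2e^{-\xi}}{\sqrt\pi}\,\Phi\left(\tfrac12-m,\tfrac32;\xi\right),$$ $$\frac1\pi\int_0^\infty\frac{e^{-\eta}L_m^{1/2}(\eta)\sqrt\eta\,d\eta}{\eta-\xi}=\frac{e^{-\xi}}{\sqrt\pi}\,\Phi\left(-\tfrac12-m,\tfrac12;\xi\right).$$
   Context: The integrals are Cauchy principal values. $L_m^\alpha(x)=\sum_{k=0}^m\binom{m+\alpha}{m-k}\frac{(-1)^kx^k}{k!}$ are the (generalized) Laguerre polynomials, with $\binom{a}{n}=\frac{\Gamma(a+1)}{n!\,\Gamma(a-n+1)}$. $\Phi(a,c;x)=\sum_{k=0}^\infty \frac{(a)_k x^k}{(c)_k k!}$ is the confluent hypergeometric function, $(a)_k=a(a+1)\cdots(a+k-1)$. *)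

theory Defs
  imports "HOL-Analysis.Analysis"
begin

definition laguerre :: "nat \<Rightarrow> real \<Rightarrow> real \<Rightarrow> real" where
  "laguerre m \<alpha> x =
     (\<Sum>k=0..m. ((real m + \<alpha>) gchoose (m - k)) * ((-1) ^ k * x ^ k / fact k))"

text \<open>
  The binomial coefficient is often defined by the quotient of Gamma functions below. It agrees
  with \<^const>\<open>gbinomial\<close> away from the poles of the numerator, in particular whenever
  \<open>\<alpha> > -1\<close> in the Laguerre polynomials.
\<close>

lemma gchoose_eq_Gamma_quotient:
  fixes a :: real
  assumes "a + 1 \<notin> \<int>\<^sub>\<le>\<^sub>0"
  shows "a gchoose n = Gamma (a + 1) / (fact n * Gamma (a - real n + 1))"
  using gbinomial_Gamma[of a n] assms by simp

definition hypergeom_1F1 :: "real \<Rightarrow> real \<Rightarrow> real \<Rightarrow> real" where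
  "hypergeom_1F1 a c x = (\<Sum>k. pochhammer a k * x ^ k / (pochhammer c k * fact k))"

text \<open>
  Cauchy principal value of the integral of \<open>f\<close> over \<open>A\<close> with a single singularity at \<open>\<xi>\<close>: the
  integral over \<open>A\<close> with a symmetric interval around \<open>\<xi>\<close> removed exists as a Lebesgue integral,
  and it converges as the interval shrinks to the point. Integrability has to be demanded
  explicitly, since the integral of a non-integrable function is 0 by convention.
\<close>

definition has_pv_integral :: "(real \<Rightarrow> real) \<Rightarrow> real set \<Rightarrow> real \<Rightarrow> real \<Rightarrow> bool" where
  "has_pv_integral f A \<xi> I \<longleftrightarrow>
     (\<forall>\<epsilon>>0. set_integrable lborel (A - {\<xi>-\<epsilon><..<\<xi>+\<epsilon>}) f) \<and>
     ((\<lambda>\<epsilon>. set_lebesgue_integral lborel (A - {\<xi>-\<epsilon><..<\<xi>+\<epsilon>}) f) \<longlongrightarrow> I) (at_right 0)"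

definition pv_integrable :: "(real \<Rightarrow> real) \<Rightarrow> real set \<Rightarrow> real \<Rightarrow> bool" where
  "pv_integrable f A \<xi> \<longleftrightarrow> (\<exists>I. has_pv_integral f A \<xi> I)"

definition pv_integral :: "(real \<Rightarrow> real) \<Rightarrow> real set \<Rightarrow> real \<Rightarrow> real" where
  "pv_integral f A \<xi> = (THE I. has_pv_integral f A \<xi> I)"

lemma pv_integral_eqI:
  assumes "has_pv_integral f A \<xi> I"
  shows "pv_integral f A \<xi> = I"
  unfolding pv_integral_def
proof (rule the_equality)
  show "has_pv_integral f A \<xi> I" by fact
next
  fix J assume "has_pv_integral f A \<xi> J"
  with assms show "J = I"
    unfolding has_pv_integral_def using tendsto_unique trivial_limit_at_right_real by blast
qed

end

theory Submission
  imports Defs "HOL-Real_Asymp.Real_Asymp"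
begin

text \<open>
  Let $A_0$ be the first principal value for $m = 0$. As
  $\mathrm{PV}\int_0^\infty d\eta/((\eta-\xi)\sqrt\eta) = 0$, the value $A_0$ is an absolutely
  convergent integral of a difference quotient of $e^{-\eta}$; the representation
  $(1-e^{-u})/u = \int_0^1 e^{-us}\,ds$ and Tonelli's theorem turn it into
  $\int_0^1 e^{\xi s}s^{-1/2}\,ds$, which is expanded in powers of $\xi$. Induction on $m$ then
  combines $\eta L_m^{1/2} = (m+1/2)L_m^{-1/2} - (m+1)L_{m+1}^{-1/2}$ and
  $L_{m+1}^{1/2} = L_m^{1/2} + L_{m+1}^{-1/2}$, the identity
  $\eta/(\eta-\xi) = 1 + \xi/(\eta-\xi)$, the orthogonality of $L_{m+1}^{-1/2}$ to constants, and
  two contiguous relations of $\Phi$.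
\<close>

section \<open>Recurrences between Laguerre polynomials of neighbouring degree and parameter\<close>

lemma laguerre_0 [simp]: "laguerre 0 \<alpha> x = 1"
  by (simp add: laguerre_def)

text \<open>Pascal's rule for generalized binomial coefficients, applied to each power of
  \<open>x\<close> up to \<open>m\<close>. The leading term \<open>k = Suc m\<close> has binomial
  coefficient 1 for either parameter, so it is shared by the two polynomials of degree
  \<open>Suc m\<close>.\<close>

lemma laguerre_Suc_upper:
  "laguerre (Suc m) (\<alpha> + 1) x = laguerre m (\<alpha> + 1) x + laguerre (Suc m) \<alpha> x"
proof -
  let ?t = "\<lambda>k. (-1) ^ k * x ^ k / fact k"
  have "((real (Suc m) + (\<alpha> + 1)) gchoose (Suc m - k)) * ?t k =
      ((real m + (\<alpha> + 1)) gchoose (m - k)) * ?t k + ((real (Suc m) + \<alpha>) gchoose (Suc m - k)) * ?t k"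
    if "k \<le> m" for k
    using gbinomial_Suc_Suc[of "real (Suc m) + \<alpha>" "m - k"] that
    by (simp add: Suc_diff_le algebra_simps)
  then have "(\<Sum>k=0..m. ((real (Suc m) + (\<alpha> + 1)) gchoose (Suc m - k)) * ?t k) =
      laguerre m (\<alpha> + 1) x + (\<Sum>k=0..m. ((real (Suc m) + \<alpha>) gchoose (Suc m - k)) * ?t k)"
    unfolding laguerre_def sum.distrib[symmetric] by (intro sum.cong refl) simp
  then show ?thesis
    by (simp add: laguerre_def)
qed

text \<open>The absorption identity \<open>n * (M gchoose n) = M * ((M - 1) gchoose (n - 1))\<close>
  with \<open>n = Suc m - k\<close> merges the two coefficients of the k-th power on the right into
  one carrying the factor \<open>- k\<close>. This factor removes the constant term and reduces
  \<open>fact k\<close>, which leaves \<open>x\<close> times a Laguerre polynomial of higher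
  parameter.\<close>

lemma mult_laguerre:
  "x * laguerre m (\<alpha> + 1) x =
     (real m + \<alpha> + 1) * laguerre m \<alpha> x - (real m + 1) * laguerre (Suc m) \<alpha> x"
proof -
  let ?t = "\<lambda>k. (-1) ^ k * x ^ k / fact k" and ?M = "real m + \<alpha> + 1"
  \<comment> \<open>The conditional pads the polynomial of degree \<open>m\<close> with a zero
    coefficient at \<open>k = Suc m\<close>. Truncated subtraction would give
    \<open>m - k = 0\<close> there, hence a wrong binomial coefficient 1.\<close>
  have coeff: "(if k \<le> m then ?M * ((real m + \<alpha>) gchoose (m - k)) else 0)
      - (real m + 1) * ((real (Suc m) + \<alpha>) gchoose (Suc m - k))
      = - real k * (?M gchoose (Suc m - k))" if "k \<le> Suc m" for k
  proof (cases "k \<le> m")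
    case True
    then have "real (Suc m - k) * (?M gchoose (Suc m - k)) = ?M * ((real m + \<alpha>) gchoose (m - k))"
      using gbinomial_absorption[of "m - k" ?M] by (simp add: Suc_diff_le algebra_simps)
    with True show ?thesis
      by (simp add: of_nat_diff algebra_simps)
  next
    case False
    with that have "k = Suc m" by simp
    then show ?thesis by simp
  qed
  have "(real m + \<alpha> + 1) * laguerre m \<alpha> x =
      (\<Sum>k=0..Suc m. (if k \<le> m then ?M * ((real m + \<alpha>) gchoose (m - k)) else 0) * ?t k)"
    by (simp add: laguerre_def sum_distrib_left mult.assoc)
  then have "(real m + \<alpha> + 1) * laguerre m \<alpha> x - (real m + 1) * laguerre (Suc m) \<alpha> x =
      (\<Sum>k=0..Suc m. ((if k \<le> m then ?M * ((real m + \<alpha>) gchoose (m - k)) else 0)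
        - (real m + 1) * ((real (Suc m) + \<alpha>) gchoose (Suc m - k))) * ?t k)"
    unfolding laguerre_def
    by (simp only: sum_distrib_left sum_subtractf[symmetric] left_diff_distrib mult.assoc)
  also have "\<dots> = (\<Sum>k=0..Suc m. - real k * (?M gchoose (Suc m - k)) * ?t k)"
    by (intro sum.cong refl) (metis atLeastAtMost_iff coeff)
  \<comment> \<open>The term \<open>k = 0\<close> vanishes because of the factor
    \<open>- real k\<close>, so the index can be shifted.\<close>
  also have "\<dots> = (\<Sum>k=0..m. - real (Suc k) * (?M gchoose (m - k)) * ?t (Suc k))"
    by (subst sum.atLeast0_atMost_Suc_shift) (simp del: of_nat_Suc fact_Suc power_Suc)
  also have "\<dots> = x * laguerre m (\<alpha> + 1) x"
    unfolding laguerre_def sum_distrib_left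
    by (intro sum.cong refl) (simp add: field_simps del: of_nat_Suc)
  finally show ?thesis by simp
qed

section \<open>The confluent hypergeometric series and its contiguous relations\<close>

text \<open>Ratio test: the quotient of consecutive terms is linear over quadratic in the index and
  tends to 0. Positivity of \<open>c\<close> keeps all denominators away from 0.\<close>

lemma summable_hypergeom_1F1:
  fixes a c x :: real
  assumes "c > 0"
  shows "summable (\<lambda>k. pochhammer a k * x ^ k / (pochhammer c k * fact k))" (is "summable ?f")
proof -
  have pos: "pochhammer c k > 0" for k
    using assms by (rule pochhammer_pos)
  have "(\<lambda>n. \<bar>a + real n\<bar> * \<bar>x\<bar> / ((c + real n) * (real n + 1))) \<longlonglongrightarrow> 0"
    by real_asymp
  then have "eventually (\<lambda>n. \<bar>a + real n\<bar> * \<bar>x\<bar> / ((c + real n) * (real n + 1)) < 1/2) sequentially"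
    by (rule order_tendstoD) simp
  then obtain N where N: "\<And>n. n \<ge> N \<Longrightarrow> \<bar>a + real n\<bar> * \<bar>x\<bar> / ((c + real n) * (real n + 1)) < 1/2"
    by (auto simp: eventually_sequentially)
  show ?thesis
  proof (rule summable_ratio_test[of "1/2" N])
    fix n assume "n \<ge> N"
    have "norm (?f (Suc n)) = \<bar>a + real n\<bar> * \<bar>x\<bar> / ((c + real n) * (real n + 1)) * norm (?f n)"
    proof -
      have "?f (Suc n) = (a + real n) * x / ((c + real n) * (real n + 1)) * ?f n"
        by (simp add: pochhammer_Suc mult_ac add_ac)
      moreover have "\<bar>(c + real n) * (real n + 1)\<bar> = (c + real n) * (real n + 1)"
        using assms by simp
      ultimately show ?thesis
        by (simp only: real_norm_def abs_mult abs_divide)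
    qed
    also have "\<dots> \<le> 1/2 * norm (?f n)"
      using N[OF \<open>n \<ge> N\<close>] by (intro mult_right_mono) auto
    finally show "norm (?f (Suc n)) \<le> 1/2 * norm (?f n)" .
  qed simp
qed

lemma hypergeom_1F1_sums:
  fixes a c x :: real
  assumes "c > 0"
  shows "(\<lambda>k. pochhammer a k * x ^ k / (pochhammer c k * fact k)) sums hypergeom_1F1 a c x"
  unfolding hypergeom_1F1_def by (intro summable_sums summable_hypergeom_1F1 assms)

lemma hypergeom_1F1_same:
  assumes "c > 0"
  shows "hypergeom_1F1 c c x = exp x"
proof -
  have "pochhammer c k \<noteq> 0" for k
    using pochhammer_pos[OF assms, of k] by simp
  then have "(\<lambda>k. x ^ k / fact k) sums hypergeom_1F1 c c x"
    using hypergeom_1F1_sums[OF assms, of c x] by simp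
  then show ?thesis
    using exp_converges[of x] by (simp add: sums_unique2 field_simps scaleR_conv_of_real)
qed

text \<open>Holds term by term. Splitting a factor off either end of a Pochhammer symbol gives
  \<open>a * pochhammer (a + 1) k = pochhammer a k * (a + real k)\<close>, and likewise for
  \<open>c\<close>; then \<open>(c - a) + (a + k) = c + k\<close>. It supplies the recursion of the
  first principal value in the induction.\<close>

lemma hypergeom_1F1_contiguous_lower:
  assumes "c > 0"
  shows "c * hypergeom_1F1 a c x =
    (c - a) * hypergeom_1F1 a (c + 1) x + a * hypergeom_1F1 (a + 1) (c + 1) x"
proof -
  let ?g = "\<lambda>a c k. pochhammer a k * x ^ k / (pochhammer c k * fact k) :: real"
  have coeff: "c * ?g a c k = (c - a) * ?g a (c + 1) k + a * ?g (a + 1) (c + 1) k" for k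
  proof -
    have pos: "pochhammer c k > 0" "pochhammer (c + 1) k > 0"
      using assms by (auto intro!: pochhammer_pos)
    have c: "c * pochhammer (c + 1) k = pochhammer c k * (c + real k)"
      by (metis pochhammer_Suc pochhammer_rec)
    have a: "a * pochhammer (a + 1) k = pochhammer a k * (a + real k)"
      by (metis pochhammer_Suc pochhammer_rec)
    have "(c - a) * ?g a (c + 1) k + a * ?g (a + 1) (c + 1) k =
        ((c - a) * pochhammer a k + a * pochhammer (a + 1) k) * x ^ k / (pochhammer (c + 1) k * fact k)"
      by (simp only: distrib_right add_divide_distrib times_divide_eq_right mult.assoc)
    also have "\<dots> = pochhammer a k * (c + real k) * x ^ k / (pochhammer c k * (c + real k) / c * fact k)"
    proof -
      have "(c - a) * pochhammer a k + a * pochhammer (a + 1) k = pochhammer a k * (c + real k)"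
        unfolding a by (simp add: algebra_simps)
      moreover have "pochhammer (c + 1) k = pochhammer c k * (c + real k) / c"
        using c assms by (simp add: field_simps)
      ultimately show ?thesis by (simp only:)
    qed
    also have "\<dots> = c * ?g a c k"
    proof -
      have "p * n * y / (q * n / c * f) = c * (p * y / (q * f))" if "n \<noteq> 0" for p n y q f :: real
        using assms that by (simp add: field_simps)
      then show ?thesis
        using assms by simp
    qed
    finally show ?thesis by simp
  qed
  have "(\<lambda>k. c * ?g a c k) sums
      ((c - a) * hypergeom_1F1 a (c + 1) x + a * hypergeom_1F1 (a + 1) (c + 1) x)"
    unfolding coeff using assms by (intro sums_add sums_mult hypergeom_1F1_sums) auto
  then show ?thesis
    using sums_mult[OF hypergeom_1F1_sums[OF assms], of c a x] sums_unique2 by blast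
qed

text \<open>Lowering \<open>a\<close> by 1 changes \<open>pochhammer a (Suc k)\<close> by
  \<open>(k + 1) * pochhammer a k\<close>. The factor \<open>k + 1\<close> cancels in
  \<open>fact (Suc k)\<close>, and \<open>pochhammer c (Suc k) = c * pochhammer (c + 1) k\<close>
  raises the lower parameter. It supplies the recursion of the second principal value.\<close>

lemma hypergeom_1F1_contiguous_upper:
  assumes "c > 0"
  shows "c * hypergeom_1F1 (a - 1) c x = c * hypergeom_1F1 a c x - x * hypergeom_1F1 a (c + 1) x"
proof -
  let ?g = "\<lambda>a c k. pochhammer a k * x ^ k / (pochhammer c k * fact k) :: real"
  have coeff: "c * ?g a c (Suc k) - c * ?g (a - 1) c (Suc k) = x * ?g a (c + 1) k" for k
  proof -
    have pos: "pochhammer (c + 1) k > 0"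
      using assms by (auto intro!: pochhammer_pos)
    have a: "pochhammer a (Suc k) - pochhammer (a - 1) (Suc k) = (real k + 1) * pochhammer a k"
      using pochhammer_rec[of "a - 1" k] by (simp add: pochhammer_Suc algebra_simps)
    have "c * ?g a c (Suc k) - c * ?g (a - 1) c (Suc k) =
       c * (pochhammer a (Suc k) - pochhammer (a - 1) (Suc k)) * x ^ Suc k / (pochhammer c (Suc k) * fact (Suc k))"
      by (simp only: right_diff_distrib left_diff_distrib diff_divide_distrib times_divide_eq_right mult.assoc)
    also have "\<dots> = x * ?g a (c + 1) k"
    proof -
      have "c * (n * p) * (x * y) / (c * q * (n * f)) = x * (p * y / (q * f))"
        if "n \<noteq> 0" "q \<noteq> 0" "f \<noteq> 0" for n p y q f :: real
        using assms that by (simp add: field_simps)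
      from this[of "real k + 1" "pochhammer (c + 1) k" "fact k" "pochhammer a k" "x ^ k"]
      show ?thesis
        unfolding a pochhammer_rec[of c] fact_Suc power_Suc using pos by (simp add: add.commute)
    qed
    finally show ?thesis .
  qed
  have "(\<lambda>k. c * ?g a c k - c * ?g (a - 1) c k) sums
      (c * hypergeom_1F1 a c x - c * hypergeom_1F1 (a - 1) c x)"
    using assms by (intro sums_diff sums_mult hypergeom_1F1_sums) auto
  \<comment> \<open>Both series start with the same constant, so the difference has zeroth term 0
    and may be shifted by one index without changing its sum.\<close>
  then have "(\<lambda>k. x * ?g a (c + 1) k) sums
      (c * hypergeom_1F1 a c x - c * hypergeom_1F1 (a - 1) c x)"
    unfolding coeff[symmetric] by (subst sums_Suc_iff) simp
  moreover have "(\<lambda>k. x * ?g a (c + 1) k) sums (x * hypergeom_1F1 a (c + 1) x)"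
    using assms by (intro sums_mult hypergeom_1F1_sums) auto
  ultimately have "c * hypergeom_1F1 a c x - c * hypergeom_1F1 (a - 1) c x =
      x * hypergeom_1F1 a (c + 1) x"
    by (rule sums_unique2)
  then show ?thesis by simp
qed

section \<open>Rules for principal values\<close>

text \<open>Every removed interval contains \<open>\<xi>\<close>, so the integrands never have to be
  compared at the singularity.\<close>

lemma has_pv_integral_cong:
  assumes "\<And>x. x \<in> A \<Longrightarrow> x \<noteq> \<xi> \<Longrightarrow> f x = g x"
  shows "has_pv_integral f A \<xi> I \<longleftrightarrow> has_pv_integral g A \<xi> I"
proof -
  have ind: "indicator (A - {\<xi>-\<epsilon><..<\<xi>+\<epsilon>}) x *\<^sub>R f x = indicator (A - {\<xi>-\<epsilon><..<\<xi>+\<epsilon>}) x *\<^sub>R g x"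
    if "\<epsilon> > 0" for x \<epsilon>
    using assms that by (cases "x = \<xi>") (auto simp: indicator_def)
  have int: "set_integrable lborel (A - {\<xi>-\<epsilon><..<\<xi>+\<epsilon>}) f = set_integrable lborel (A - {\<xi>-\<epsilon><..<\<xi>+\<epsilon>}) g"
    if "\<epsilon> > 0" for \<epsilon>
    unfolding set_integrable_def ind[OF that] ..
  have "((\<lambda>\<epsilon>. set_lebesgue_integral lborel (A - {\<xi>-\<epsilon><..<\<xi>+\<epsilon>}) f) \<longlongrightarrow> I) (at_right 0) \<longleftrightarrow>
     ((\<lambda>\<epsilon>. set_lebesgue_integral lborel (A - {\<xi>-\<epsilon><..<\<xi>+\<epsilon>}) g) \<longlongrightarrow> I) (at_right 0)"
    unfolding set_lebesgue_integral_def
    by (intro tendsto_cong eventually_mono[OF eventually_at_right_less]) (simp only: ind)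
  with int show ?thesis
    unfolding has_pv_integral_def by blast
qed

lemma has_pv_integral_add:
  assumes f: "has_pv_integral f A \<xi> I" and g: "has_pv_integral g A \<xi> J"
  shows "has_pv_integral (\<lambda>x. f x + g x) A \<xi> (I + J)"
proof -
  have int: "set_integrable lborel (A - {\<xi>-\<epsilon><..<\<xi>+\<epsilon>}) f" "set_integrable lborel (A - {\<xi>-\<epsilon><..<\<xi>+\<epsilon>}) g"
    if "\<epsilon> > 0" for \<epsilon>
    using assms that by (auto simp: has_pv_integral_def)
  have "((\<lambda>\<epsilon>. set_lebesgue_integral lborel (A - {\<xi>-\<epsilon><..<\<xi>+\<epsilon>}) f
        + set_lebesgue_integral lborel (A - {\<xi>-\<epsilon><..<\<xi>+\<epsilon>}) g) \<longlongrightarrow> I + J) (at_right 0)"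
    using assms by (intro tendsto_add) (auto simp: has_pv_integral_def)
  moreover have "eventually (\<lambda>\<epsilon>. set_lebesgue_integral lborel (A - {\<xi>-\<epsilon><..<\<xi>+\<epsilon>}) f
        + set_lebesgue_integral lborel (A - {\<xi>-\<epsilon><..<\<xi>+\<epsilon>}) g
        = set_lebesgue_integral lborel (A - {\<xi>-\<epsilon><..<\<xi>+\<epsilon>}) (\<lambda>x. f x + g x)) (at_right 0)"
    using int by (intro eventually_mono[OF eventually_at_right_less]) simp
  ultimately have "((\<lambda>\<epsilon>. set_lebesgue_integral lborel (A - {\<xi>-\<epsilon><..<\<xi>+\<epsilon>}) (\<lambda>x. f x + g x))
      \<longlongrightarrow> I + J) (at_right 0)"
    by (rule Lim_transform_eventually)
  with int show ?thesis
    by (simp add: has_pv_integral_def)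
qed

lemma has_pv_integral_cmult:
  assumes "has_pv_integral f A \<xi> I"
  shows "has_pv_integral (\<lambda>x. c * f x) A \<xi> (c * I)"
  using assms unfolding has_pv_integral_def by (auto intro: tendsto_mult_left)

text \<open>Dominated convergence with the absolute value of \<open>f\<close> on \<open>A\<close> as
  majorant: the removed intervals shrink to a null set.\<close>

lemma has_pv_integral_of_integrable:
  assumes f: "set_integrable lborel A f" and A: "A \<in> sets borel"
  shows "has_pv_integral f A \<xi> (set_lebesgue_integral lborel A f)"
proof -
  have int: "set_integrable lborel (A - {\<xi>-\<epsilon><..<\<xi>+\<epsilon>}) f" for \<epsilon>
    by (rule set_integrable_subset[OF f]) (use A in auto)
  have "((\<lambda>\<epsilon>. set_lebesgue_integral lborel (A - {\<xi>-\<epsilon><..<\<xi>+\<epsilon>}) f)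
      \<longlongrightarrow> set_lebesgue_integral lborel A f) (at_right 0)"
  proof (rule tendsto_at_right_sequentially[of 0 1])
    fix S :: "nat \<Rightarrow> real"
    assume S: "\<And>n. 0 < S n" "S \<longlonglongrightarrow> 0"
    show "(\<lambda>n. set_lebesgue_integral lborel (A - {\<xi>-S n<..<\<xi>+S n}) f)
        \<longlonglongrightarrow> set_lebesgue_integral lborel A f"
      unfolding set_lebesgue_integral_def
    proof (rule integral_dominated_convergence)
      show "integrable lborel (\<lambda>x. norm (indicator A x *\<^sub>R f x))"
        using f unfolding set_integrable_def by (rule integrable_norm)
      show "(\<lambda>x. indicat_real A x *\<^sub>R f x) \<in> borel_measurable lborel"
        using f unfolding set_integrable_def by (rule borel_measurable_integrable)
      show "(\<lambda>x. indicat_real (A - {\<xi> - S i<..<\<xi> + S i}) x *\<^sub>R f x) \<in> borel_measurable lborel" for i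
        using int[of "S i"] unfolding set_integrable_def by (rule borel_measurable_integrable)
      show "AE x in lborel. norm (indicat_real (A - {\<xi> - S i<..<\<xi> + S i}) x *\<^sub>R f x)
          \<le> norm (indicat_real A x *\<^sub>R f x)" for i
        by (auto simp: indicator_def)
      show "AE x in lborel. (\<lambda>i. indicat_real (A - {\<xi> - S i<..<\<xi> + S i}) x *\<^sub>R f x)
          \<longlonglongrightarrow> indicat_real A x *\<^sub>R f x"
      \<comment> \<open>Only the null set containing \<open>\<xi>\<close> alone is exceptional. At
        any other point the sequence becomes constant once \<open>S n\<close> is below the distance
        to \<open>\<xi>\<close>.\<close>
      proof (rule AE_mp[OF AE_lborel_singleton[of \<xi>]], intro AE_I2 impI)
        fix x assume "x \<noteq> \<xi>"
        then have "eventually (\<lambda>n. S n < \<bar>x - \<xi>\<bar>) sequentially"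
          by (intro order_tendstoD[OF S(2)]) simp
        then have "eventually (\<lambda>n. indicat_real A x *\<^sub>R f x =
            indicat_real (A - {\<xi> - S n<..<\<xi> + S n}) x *\<^sub>R f x) sequentially"
          by eventually_elim (auto simp: indicator_def)
        then show "(\<lambda>i. indicat_real (A - {\<xi> - S i<..<\<xi> + S i}) x *\<^sub>R f x)
            \<longlonglongrightarrow> indicat_real A x *\<^sub>R f x"
          by (rule Lim_transform_eventually[OF tendsto_const])
      qed
    qed
  qed simp
  with int show ?thesis
    by (simp add: has_pv_integral_def)
qed

section \<open>Gamma integrals and orthogonality\<close>

lemma set_integrable_Gamma:
  fixes s :: real
  assumes "s > 0"
  shows "set_integrable lborel {0<..} (\<lambda>t. exp (-t) * t powr (s - 1))"
    and "set_lebesgue_integral lborel {0<..} (\<lambda>t. exp (-t) * t powr (s - 1)) = Gamma s"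
proof -
  have "(\<integral>\<^sup>+t. ennreal (indicator {0<..} t *\<^sub>R (exp (-t) * t powr (s - 1))) \<partial>lborel) = ennreal (Gamma s)"
    unfolding Gamma_conv_nn_integral_real[OF assms]
    by (intro nn_integral_cong) (auto simp: indicator_def exp_minus field_simps)
  then have "has_bochner_integral lborel (\<lambda>t. indicator {0<..} t *\<^sub>R (exp (-t) * t powr (s - 1))) (Gamma s)"
    using assms by (intro has_bochner_integral_nn_integral) (auto simp: indicator_def Gamma_real_pos less_imp_le)
  then show "set_integrable lborel {0<..} (\<lambda>t. exp (-t) * t powr (s - 1))"
    "set_lebesgue_integral lborel {0<..} (\<lambda>t. exp (-t) * t powr (s - 1)) = Gamma s"
    by (auto simp: set_integrable_def set_lebesgue_integral_def has_bochner_integral_iff)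
qed

text \<open>The exponent is kept in the form \<open>s - 1\<close> with
  \<open>s = real k + 1/2\<close>, so that it matches the Gamma integral.\<close>

lemma powr_half_eq_power_divide_sqrt: "t > 0 \<Longrightarrow> t powr (real k + 1/2 - 1) = t ^ k / sqrt t"
  for t :: real
  using powr_diff[of t "real k" "1/2"] by (simp add: powr_realpow powr_half_sqrt)

lemma set_integral_sum:
  fixes f :: "'i \<Rightarrow> 'a \<Rightarrow> real"
  assumes "\<And>i. i \<in> I \<Longrightarrow> set_integrable M A (f i)"
  shows set_integrable_sum: "set_integrable M A (\<lambda>x. \<Sum>i\<in>I. f i x)"
    and set_integral_sum_eq: "set_lebesgue_integral M A (\<lambda>x. \<Sum>i\<in>I. f i x) = (\<Sum>i\<in>I. set_lebesgue_integral M A (f i))"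
  using assms unfolding set_integrable_def set_lebesgue_integral_def scaleR_sum_right
  by (auto intro: Bochner_Integration.integrable_sum Bochner_Integration.integral_sum)

text \<open>Integrating the k-th power against the weight \<open>exp (-\<eta>) / sqrt \<eta>\<close>
  gives \<open>Gamma (real k + 1/2)\<close>, which cancels the same factor in the denominator of the
  k-th coefficient. What remains is a multiple of the alternating sum of a row of Pascal's triangle;
  it is 0 for positive \<open>m\<close>, and for \<open>m = 0\<close> only
  \<open>Gamma (1/2)\<close> is left.\<close>

lemma laguerre_minus_half_orthogonal_1:
  "set_integrable lborel {0<..} (\<lambda>\<eta>. exp (-\<eta>) * laguerre m (-1/2) \<eta> / sqrt \<eta>)"
  "set_lebesgue_integral lborel {0<..} (\<lambda>\<eta>. exp (-\<eta>) * laguerre m (-1/2) \<eta> / sqrt \<eta>)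
    = (if m = 0 then sqrt pi else 0)"
proof -
  let ?w = "\<lambda>k \<eta>. exp (-\<eta>) * \<eta> powr (real k + 1/2 - 1) :: real"
  let ?b = "\<lambda>k. ((real m + (-1/2)) gchoose (m - k)) * ((-1) ^ k / fact k)"
  have eq: "exp (-\<eta>) * laguerre m (-1/2) \<eta> / sqrt \<eta> = (\<Sum>k=0..m. ?b k * ?w k \<eta>)"
    if "\<eta> \<in> {0<..}" for \<eta> :: real
    unfolding laguerre_def sum_distrib_left sum_divide_distrib
    using that powr_half_eq_power_divide_sqrt[of \<eta>]
    by (intro sum.cong refl) (simp only: greaterThan_iff, simp)
  have w: "set_integrable lborel {0<..} (?w k)"
    "set_lebesgue_integral lborel {0<..} (?w k) = Gamma (real k + 1/2)" for k
    by (rule set_integrable_Gamma; simp)+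
  have "set_integrable lborel {0<..} (\<lambda>\<eta>. \<Sum>k=0..m. ?b k * ?w k \<eta>)"
    using w(1) by (intro set_integrable_sum set_integrable_mult_right) auto
  then show "set_integrable lborel {0<..} (\<lambda>\<eta>. exp (-\<eta>) * laguerre m (-1/2) \<eta> / sqrt \<eta>)"
    by (subst set_integrable_cong[OF refl refl eq])
  have "set_lebesgue_integral lborel {0<..} (\<lambda>\<eta>. exp (-\<eta>) * laguerre m (-1/2) \<eta> / sqrt \<eta>)
      = set_lebesgue_integral lborel {0<..} (\<lambda>\<eta>. \<Sum>k=0..m. ?b k * ?w k \<eta>)"
    using eq by (intro set_lebesgue_integral_cong) auto
  also have "\<dots> = (\<Sum>k=0..m. ?b k * Gamma (real k + 1/2))"
    using w by (subst set_integral_sum_eq) auto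
  also have "\<dots> = (\<Sum>k\<le>m. Gamma (real m + 1/2) / fact m * ((-1) ^ k * of_nat (m choose k)))"
  proof (intro sum.cong)
    fix k assume "k \<in> {..m}"
    then have k: "k \<le> m" "real m + (-1/2) - real (m - k) + 1 = real k + 1/2"
      by (auto simp: of_nat_diff)
    have m: "real m + (-1/2) + 1 = real m + 1/2"
      by simp
    have pos: "Gamma (real k + 1/2) > 0"
      by (intro Gamma_real_pos) auto
    \<comment> \<open>A half-integer is not a pole of Gamma, so the binomial coefficient may be
      written as a Gamma quotient.\<close>
    have "real m + (-1/2) + 1 \<notin> \<int>\<^sub>\<le>\<^sub>0"
      by (auto simp: nonpos_Ints_def)
    then have b: "(real m + (-1/2)) gchoose (m - k) =
        Gamma (real m + 1/2) / (fact (m - k) * Gamma (real k + 1/2))"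
      by (subst gchoose_eq_Gamma_quotient) (assumption, simp only: k(2) m)
    show "?b k * Gamma (real k + 1/2) =
        Gamma (real m + 1/2) / fact m * ((-1) ^ k * of_nat (m choose k))"
    proof -
      have "G / (d * g) * (s / e) * g = G / f * (s * (f / (e * d)))"
        if "g \<noteq> 0" "f \<noteq> 0" for G d g s e f :: real
        using that by (simp add: field_simps)
      moreover have "Gamma (real k + 1/2) \<noteq> 0"
        using pos by (rule less_imp_neq[symmetric])
      ultimately show ?thesis
        unfolding b binomial_fact[OF k(1)] by (metis fact_nonzero)
    qed
  qed auto
  also have "\<dots> = (if m = 0 then sqrt pi else 0)"
    unfolding sum_distrib_left[symmetric]
    using choose_alternating_sum[of m, where ?'a = real] by (auto simp: Gamma_one_half_real)
  finally show "set_lebesgue_integral lborel {0<..} (\<lambda>\<eta>. exp (-\<eta>) * laguerre m (-1/2) \<eta> / sqrt \<eta>)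
    = (if m = 0 then sqrt pi else 0)" .
qed

section \<open>The vanishing principal value of the bare kernel\<close>

text \<open>Explicit antiderivatives on the two sides of \<open>\<xi>\<close> vanish at 0 and at
  infinity, so only their values at \<open>\<xi> - \<epsilon>\<close> and
  \<open>\<xi> + \<epsilon>\<close> enter. The terms \<open>ln \<epsilon>\<close> of the two sides
  cancel, and the rest is continuous with limit 0.\<close>

lemma has_pv_integral_inverse_sqrt_kernel:
  assumes "0 < \<xi>"
  shows "has_pv_integral (\<lambda>\<eta>. 1 / ((\<eta> - \<xi>) * sqrt \<eta>)) {0<..} \<xi> 0"
proof -
  define x where "x = sqrt \<xi>"
  let ?f = "\<lambda>\<eta>. 1 / ((\<eta> - \<xi>) * sqrt \<eta>)"
  let ?A = "\<lambda>\<epsilon>. {0<..} - {\<xi>-\<epsilon><..<\<xi>+\<epsilon>}"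
  have x: "x > 0" "x * x = \<xi>"
    using assms by (auto simp: x_def)
  have below: "sqrt \<eta> < x \<longleftrightarrow> \<eta> < \<xi>" and above: "x < sqrt \<eta> \<longleftrightarrow> \<xi> < \<eta>" for \<eta>
    by (auto simp: x_def)
  \<comment> \<open>With \<open>y = sqrt \<eta>\<close> the kernel becomes 2 dy / (y^2 - x^2), and
    partial fractions give these logarithms. \<open>G\<close> belongs to the negated kernel, which
    is nonnegative below \<open>\<xi>\<close>, as the fundamental theorem applied later demands a
    nonnegative integrand.\<close>
  define G where "G = (\<lambda>\<eta>. (ln (x + sqrt \<eta>) - ln (x - sqrt \<eta>)) / x)"
  define H where "H = (\<lambda>\<eta>. (ln (sqrt \<eta> - x) - ln (sqrt \<eta> + x)) / x)"
  have sq: "\<eta> - \<xi> = (sqrt \<eta> - x) * (sqrt \<eta> + x)" if "\<eta> \<ge> 0" for \<eta>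
    using that x by (simp add: algebra_simps)
  have G': "(G has_real_derivative - ?f \<eta>) (at \<eta>)" if "0 < \<eta>" "\<eta> < \<xi>" for \<eta>
  proof -
    define y where "y = sqrt \<eta>"
    have y: "0 < y" "y < x" using that below by (auto simp: y_def)
    then have pos: "x + y > 0" using x by simp
    have "(G has_real_derivative ((inverse y / 2 / (x + y) + inverse y / 2 / (x - y)) / x)) (at \<eta>)"
      unfolding G_def using that x y pos unfolding y_def
      by (auto intro!: derivative_eq_intros simp: divide_simps)
    also have "(inverse y / 2 / (x + y) + inverse y / 2 / (x - y)) / x = - (1 / ((y - x) * (y + x) * y))"
      using x y pos by (simp add: divide_simps) (simp add: algebra_simps)
    finally show ?thesis
      using that sq[of \<eta>] by (simp add: y_def)
  qed
  have H': "(H has_real_derivative ?f \<eta>) (at \<eta>)" if "\<xi> < \<eta>" for \<eta>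
  proof -
    define y where "y = sqrt \<eta>"
    have y: "0 < y" "x < y" "0 < \<eta>" using that above assms by (auto simp: y_def)
    then have pos: "y + x > 0" using x by simp
    have "(H has_real_derivative ((inverse y / 2 / (y - x) - inverse y / 2 / (y + x)) / x)) (at \<eta>)"
      unfolding H_def using that x y pos unfolding y_def
      by (auto intro!: derivative_eq_intros simp: divide_simps)
    also have "(inverse y / 2 / (y - x) - inverse y / 2 / (y + x)) / x = 1 / ((y - x) * (y + x) * y)"
      using x y pos by (simp add: divide_simps)
    finally show ?thesis
      using y sq[of \<eta>] by (simp add: y_def)
  qed
  have G_int: "set_integrable lborel {0<..<a} ?f" "set_lebesgue_integral lborel {0<..<a} ?f = - G a"
    if a: "0 < a" "a < \<xi>" for a
  proof -
    have "(G \<longlongrightarrow> G 0) (at_right 0)"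
      unfolding G_def using x by (intro tendsto_intros) auto
    moreover have "(G \<longlongrightarrow> G a) (at_left a)"
      using DERIV_isCont[OF G'[OF a]] unfolding isCont_def by (rule filterlim_mono) (auto simp: at_le)
    ultimately have lim: "((G \<circ> real_of_ereal) \<longlongrightarrow> G 0) (at_right (ereal 0))"
      "((G \<circ> real_of_ereal) \<longlongrightarrow> G a) (at_left (ereal a))"
      by (auto simp: ereal_tendsto_simps1)
    have cont: "isCont (\<lambda>\<eta>. - ?f \<eta>) \<eta>" if "0 < \<eta>" "\<eta> < \<xi>" for \<eta>
      using that by (intro continuous_intros) auto
    have nonneg: "0 \<le> - ?f \<eta>" if "0 < \<eta>" "\<eta> < \<xi>" for \<eta>
      using that by (simp add: divide_nonpos_nonpos mult_nonpos_nonneg)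
    have "set_integrable lborel (einterval (ereal 0) (ereal a)) (\<lambda>\<eta>. - ?f \<eta>)"
      "(LBINT \<eta>=ereal 0..ereal a. - ?f \<eta>) = G a - G 0"
      by (rule interval_integral_FTC_nonneg[where F = G];
          use a lim G' cont nonneg in \<open>auto intro!: AE_I2\<close>)+
    then have *: "set_integrable lborel {0<..<a} (\<lambda>\<eta>. - ?f \<eta>)"
      "(LBINT \<eta>:{0<..<a}. - ?f \<eta>) = G a"
      using a by (simp_all only: interval_lebesgue_integral_def) (auto simp: G_def einterval_eq)
    from set_integrable_mult_right[OF *(1), of "-1"] show "set_integrable lborel {0<..<a} ?f"
      by simp
    from this *(2) show "set_lebesgue_integral lborel {0<..<a} ?f = - G a"
      by (simp add: set_integral_uminus)
  qed
  have H_int: "set_integrable lborel {b<..} ?f" "set_lebesgue_integral lborel {b<..} ?f = - H b"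
    if b: "\<xi> < b" for b
  proof -
    have "(H \<longlongrightarrow> 0) at_top"
      unfolding H_def using x by real_asymp
    moreover have "(H \<longlongrightarrow> H b) (at_right b)"
      using DERIV_isCont[OF H'[OF b]] unfolding isCont_def by (rule filterlim_mono) (auto simp: at_le)
    ultimately have lim: "((H \<circ> real_of_ereal) \<longlongrightarrow> H b) (at_right (ereal b))"
      "((H \<circ> real_of_ereal) \<longlongrightarrow> 0) (at_left \<infinity>)"
      by (auto simp: ereal_tendsto_simps1)
    have cont: "isCont ?f \<eta>" if "\<xi> < \<eta>" for \<eta>
      using that assms by (intro continuous_intros) auto
    have "set_integrable lborel (einterval (ereal b) \<infinity>) ?f"
      "(LBINT \<eta>=ereal b..\<infinity>. ?f \<eta>) = 0 - H b"
      by (rule interval_integral_FTC_nonneg[where F = H];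
          use assms b lim H' cont in \<open>auto intro!: AE_I2\<close>)+
    then show "set_integrable lborel {b<..} ?f" "set_lebesgue_integral lborel {b<..} ?f = - H b"
      by (simp_all only: interval_lebesgue_integral_def) (auto simp: einterval_eq)
  qed
  have val: "set_integrable lborel (?A \<epsilon>) ?f"
    "set_lebesgue_integral lborel (?A \<epsilon>) ?f =
      2 * (ln (sqrt (\<xi> + \<epsilon>) + x) - ln (x + sqrt (\<xi> - \<epsilon>))) / x"
    if \<epsilon>: "0 < \<epsilon>" "\<epsilon> < \<xi>" for \<epsilon>
  proof -
    let ?a = "\<xi> - \<epsilon>" and ?b = "\<xi> + \<epsilon>"
    \<comment> \<open>The cut-out domain also contains the end points of the removed open interval,
      which form a null set.\<close>
    have diff: "(?A \<epsilon> - ({0<..<?a} \<union> {?b<..})) \<union> (({0<..<?a} \<union> {?b<..}) - ?A \<epsilon>) \<subseteq> {?a, ?b}"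
      using \<epsilon> by auto
    have "set_integrable lborel ({0<..<?a} \<union> {?b<..}) ?f"
      using \<epsilon> by (intro set_integrable_Un G_int H_int) auto
    then show "set_integrable lborel (?A \<epsilon>) ?f"
      by (subst set_integrable_discrete_difference[OF _ diff]) auto
    have "set_lebesgue_integral lborel (?A \<epsilon>) ?f =
        set_lebesgue_integral lborel ({0<..<?a} \<union> {?b<..}) ?f"
      by (rule set_integral_discrete_difference[OF _ diff]) auto
    also have "\<dots> = set_lebesgue_integral lborel {0<..<?a} ?f + set_lebesgue_integral lborel {?b<..} ?f"
      using \<epsilon> by (intro set_integral_Un G_int H_int) auto
    also have "\<dots> = - G ?a - H ?b"
      using \<epsilon> by (simp add: G_int H_int)
    \<comment> \<open>The product of \<open>x - sqrt ?a\<close> and \<open>x + sqrt ?a\<close> is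
      \<open>\<epsilon>\<close>; this isolates the divergent part \<open>ln \<epsilon>\<close>. The
      same factorization at \<open>?b\<close> gives it with the opposite sign.\<close>
    also have "G ?a = (2 * ln (x + sqrt ?a) - ln \<epsilon>) / x"
    proof -
      have pos: "x + sqrt ?a > 0"
        using x \<epsilon> by (simp add: add_pos_nonneg)
      then have "x - sqrt ?a = \<epsilon> / (x + sqrt ?a)"
        using sq[of ?a] \<epsilon> by (simp add: field_simps)
      with pos \<epsilon> have "ln (x - sqrt ?a) = ln \<epsilon> - ln (x + sqrt ?a)"
        by (simp add: ln_div)
      then show ?thesis
        by (simp add: G_def)
    qed
    also have "H ?b = (ln \<epsilon> - 2 * ln (sqrt ?b + x)) / x"
    proof -
      have pos: "sqrt ?b + x > 0"
        using x \<epsilon> by (simp add: add_nonneg_pos)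
      then have "sqrt ?b - x = \<epsilon> / (sqrt ?b + x)"
        using sq[of ?b] \<epsilon> by (simp add: field_simps)
      with pos \<epsilon> have "ln (sqrt ?b - x) = ln \<epsilon> - ln (sqrt ?b + x)"
        by (simp add: ln_div)
      then show ?thesis
        by (simp add: H_def)
    qed
    finally show "set_lebesgue_integral lborel (?A \<epsilon>) ?f =
      2 * (ln (sqrt (\<xi> + \<epsilon>) + x) - ln (x + sqrt (\<xi> - \<epsilon>))) / x"
      by (simp add: diff_divide_distrib algebra_simps)
  qed
  have "((\<lambda>\<epsilon>. 2 * (ln (sqrt (\<xi> + \<epsilon>) + x) - ln (x + sqrt (\<xi> - \<epsilon>))) / x) \<longlongrightarrow>
      2 * (ln (sqrt (\<xi> + 0) + x) - ln (x + sqrt (\<xi> - 0))) / x) (at_right 0)"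
    using x assms by (intro tendsto_intros) (auto simp: x_def)
  then have "((\<lambda>\<epsilon>. 2 * (ln (sqrt (\<xi> + \<epsilon>) + x) - ln (x + sqrt (\<xi> - \<epsilon>))) / x) \<longlongrightarrow> 0) (at_right 0)"
    by (simp add: add.commute x_def)
  moreover have "eventually (\<lambda>\<epsilon>. 2 * (ln (sqrt (\<xi> + \<epsilon>) + x) - ln (x + sqrt (\<xi> - \<epsilon>))) / x =
      set_lebesgue_integral lborel (?A \<epsilon>) ?f) (at_right 0)"
    using eventually_at_right_less eventually_at_right_real[OF assms]
    by eventually_elim (simp add: val(2))
  ultimately have lim: "((\<lambda>\<epsilon>. set_lebesgue_integral lborel (?A \<epsilon>) ?f) \<longlongrightarrow> 0) (at_right 0)"
    by (rule Lim_transform_eventually)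
  \<comment> \<open>For \<open>\<epsilon>\<close> of size \<open>\<xi>\<close> or more, the domain
    is contained in the one for \<open>\<xi> / 2\<close>, where integrability is known.\<close>
  have int: "set_integrable lborel (?A \<epsilon>) ?f" if "\<epsilon> > 0" for \<epsilon>
    by (rule set_integrable_subset[OF val(1)[of "min \<epsilon> (\<xi> / 2)"]]) (use assms that in auto)
  from lim int show ?thesis
    by (simp add: has_pv_integral_def)
qed

section \<open>The first principal value in degree 0\<close>

text \<open>\<open>Gamma (1/2) = sqrt pi\<close> after rescaling the variable by \<open>s\<close>.
  Like the next lemmas it is stated for nonnegative integrals, ready for Tonelli's theorem.\<close>

lemma nn_integral_exp_div_sqrt:
  fixes s :: real
  assumes "s > 0"
  shows "(\<integral>\<^sup>+\<eta>. ennreal (indicator {0<..} \<eta> * (exp (- (\<eta> * s)) / sqrt \<eta>)) \<partial>lborel) = ennreal (sqrt pi / sqrt s)"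
proof -
  let ?h = "\<lambda>\<eta>. indicator {0<..} \<eta> * (exp (- \<eta>) / sqrt \<eta>) :: real"
  have "ennreal (sqrt pi) = (\<integral>\<^sup>+\<eta>. ennreal (?h \<eta>) \<partial>lborel)"
  proof -
    have "ennreal (sqrt pi) = (\<integral>\<^sup>+t. ennreal (indicator {0..} t * t powr (1/2 - 1) / exp t) \<partial>lborel)"
      using Gamma_conv_nn_integral_real[of "1/2"] by (simp add: Gamma_one_half_real)
    also have "\<dots> = (\<integral>\<^sup>+\<eta>. ennreal (?h \<eta>) \<partial>lborel)"
    proof (intro nn_integral_cong arg_cong[where f = ennreal])
      fix t :: real
      show "indicator {0..} t * t powr (1/2 - 1) / exp t = ?h t"
        using powr_half_eq_power_divide_sqrt[of t 0]
        by (cases "t = 0") (auto simp: indicator_def exp_minus field_simps)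
    qed
    finally show ?thesis .
  qed
  also have "\<dots> = ennreal s * (\<integral>\<^sup>+\<eta>. ennreal (?h (0 + s * \<eta>)) \<partial>lborel)"
    using assms by (subst nn_integral_real_affine[of _ s 0]) auto
  also have "(\<integral>\<^sup>+\<eta>. ennreal (?h (0 + s * \<eta>)) \<partial>lborel) =
      (\<integral>\<^sup>+\<eta>. ennreal (1 / sqrt s) * ennreal (indicator {0<..} \<eta> * (exp (- (\<eta> * s)) / sqrt \<eta>)) \<partial>lborel)"
    using assms by (intro nn_integral_cong)
      (auto simp: indicator_def zero_less_mult_iff real_sqrt_mult mult.commute simp flip: ennreal_mult)
  also have "\<dots> = ennreal (1 / sqrt s) * (\<integral>\<^sup>+\<eta>. ennreal (indicator {0<..} \<eta> * (exp (- (\<eta> * s)) / sqrt \<eta>)) \<partial>lborel)"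
    by (rule nn_integral_cmult) auto
  finally have *: "ennreal (sqrt pi) = ennreal (sqrt s) * (\<integral>\<^sup>+\<eta>. ennreal (indicator {0<..} \<eta> * (exp (- (\<eta> * s)) / sqrt \<eta>)) \<partial>lborel)"
    using assms by (simp add: mult.assoc[symmetric] ennreal_mult[symmetric] real_div_sqrt)
  have "ennreal (sqrt pi / sqrt s) = ennreal (1 / sqrt s) * ennreal (sqrt pi)"
    using assms by (simp flip: ennreal_mult)
  also have "\<dots> = (\<integral>\<^sup>+\<eta>. ennreal (indicator {0<..} \<eta> * (exp (- (\<eta> * s)) / sqrt \<eta>)) \<partial>lborel)"
    unfolding * using assms by (simp add: mult.assoc[symmetric] ennreal_mult[symmetric])
  finally show ?thesis by simp
qed

text \<open>Applied with \<open>c = \<eta> - \<xi>\<close>, which has either sign; the value is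
  positive in both cases.\<close>

lemma nn_integral_exp_0_1:
  fixes c :: real
  assumes "c \<noteq> 0"
  shows "(\<integral>\<^sup>+s. ennreal (indicator {0<..1} s * exp (- (c * s))) \<partial>lborel) = ennreal ((1 - exp (-c)) / c)"
proof -
  have "(\<integral>\<^sup>+s. ennreal (indicator {0<..1} s * exp (- (c * s))) \<partial>lborel) =
      (\<integral>\<^sup>+s. ennreal (exp (- (c * s))) * indicator {0..1} s \<partial>lborel)"
    by (rule nn_integral_cong_AE, rule AE_mp[OF AE_lborel_singleton[of 0]], rule AE_I2)
      (auto simp: indicator_def)
  also have "\<dots> = ennreal ((- exp (- (c * 1)) / c) - (- exp (- (c * 0)) / c))"
    using assms by (intro nn_integral_FTC_Icc) (auto intro!: derivative_eq_intros)
  finally show ?thesis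
    by (simp add: diff_divide_distrib)
qed

lemma nn_integral_powr_0_1:
  fixes a :: real
  assumes "a > -1"
  shows "(\<integral>\<^sup>+s. ennreal (indicator {0<..1} s * s powr a) \<partial>lborel) = ennreal (1 / (a + 1))"
proof -
  have "(\<integral>\<^sup>+s. ennreal (indicator {0<..1} s * s powr a) \<partial>lborel) =
    (\<integral>\<^sup>+s. ennreal (indicator {0..1} s * s powr a) \<partial>lborel)"
    by (intro nn_integral_cong) (auto simp: indicator_def)
  also have "\<dots> = ennreal (1 / (a + 1))"
    using nn_integral_has_integral_lebesgue[OF _ has_integral_powr_from_0[OF assms, of 1]] by simp
  finally show ?thesis .
qed

text \<open>For nonnegative \<open>\<xi>\<close> the exponential series has nonnegative terms and
  can be integrated termwise. The k-th power contributes \<open>1 / (real k + 1/2)\<close>, which is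
  twice the quotient of the Pochhammer symbols of 1/2 and 3/2.\<close>

lemma nn_integral_exp_div_sqrt_0_1:
  assumes "0 \<le> \<xi>"
  shows "(\<integral>\<^sup>+s. ennreal (indicator {0<..1} s * (exp (\<xi> * s) / sqrt s)) \<partial>lborel) =
    ennreal (2 * hypergeom_1F1 (1/2) (3/2) \<xi>)"
proof -
  have "(\<integral>\<^sup>+s. ennreal (indicator {0<..1} s * (exp (\<xi> * s) / sqrt s)) \<partial>lborel) =
      (\<integral>\<^sup>+s. (\<Sum>k. ennreal (\<xi> ^ k / fact k * (indicator {0<..1} s * s powr (real k + 1/2 - 1)))) \<partial>lborel)"
  proof (intro nn_integral_cong)
    fix s :: real
    show "ennreal (indicator {0<..1} s * (exp (\<xi> * s) / sqrt s)) =
      (\<Sum>k. ennreal (\<xi> ^ k / fact k * (indicator {0<..1} s * s powr (real k + 1/2 - 1))))"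
    proof (cases "s \<in> {0<..1}")
      case True
      have "(\<lambda>k. (\<xi> * s) ^ k / fact k / sqrt s) sums (exp (\<xi> * s) / sqrt s)"
        using exp_converges[of "\<xi> * s"] by (intro sums_divide) (simp add: field_simps)
      also have "(\<lambda>k. (\<xi> * s) ^ k / fact k / sqrt s) =
          (\<lambda>k. \<xi> ^ k / fact k * (indicator {0<..1} s * s powr (real k + 1/2 - 1)))"
        using True powr_half_eq_power_divide_sqrt[of s]
        by (intro ext) (simp only: greaterThanAtMost_iff, simp add: power_mult_distrib)
      finally show ?thesis
        using True assms by (subst suminf_ennreal2) (auto simp: sums_iff)
    qed auto
  qed
  also have "\<dots> = (\<Sum>k. \<integral>\<^sup>+s. ennreal (\<xi> ^ k / fact k) * ennreal (indicator {0<..1} s * s powr (real k + 1/2 - 1)) \<partial>lborel)"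
  proof (subst nn_integral_suminf)
    show "(\<Sum>k. \<integral>\<^sup>+s. ennreal (\<xi> ^ k / fact k * (indicator {0<..1} s * s powr (real k + 1/2 - 1))) \<partial>lborel) =
      (\<Sum>k. \<integral>\<^sup>+s. ennreal (\<xi> ^ k / fact k) * ennreal (indicator {0<..1} s * s powr (real k + 1/2 - 1)) \<partial>lborel)"
      using assms by (intro suminf_cong nn_integral_cong ennreal_mult) auto
  qed auto
  also have "\<dots> = (\<Sum>k. ennreal (2 * (pochhammer (1/2) k * \<xi> ^ k / (pochhammer (3/2) k * fact k))))"
  proof (intro suminf_cong)
    fix k
    have "(1/2 :: real) * pochhammer (3/2) k = pochhammer (1/2) k * (1/2 + real k)"
      using pochhammer_rec[of "1/2 :: real" k] by (simp add: pochhammer_Suc)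
    moreover have "pochhammer (3/2 :: real) k > 0"
      by (simp add: pochhammer_pos)
    ultimately have "1 / (real k + 1/2) = 2 * (pochhammer (1/2) k / pochhammer (3/2) k)"
      by (simp add: field_simps)
    then have eq: "\<xi> ^ k / fact k * (1 / (real k + 1/2)) =
        2 * (pochhammer (1/2) k * \<xi> ^ k / (pochhammer (3/2) k * fact k))"
      by (simp add: mult_ac)
    have "(\<integral>\<^sup>+s. ennreal (\<xi> ^ k / fact k) * ennreal (indicator {0<..1} s * s powr (real k + 1/2 - 1)) \<partial>lborel)
        = ennreal (\<xi> ^ k / fact k) * (\<integral>\<^sup>+s. ennreal (indicator {0<..1} s * s powr (real k + 1/2 - 1)) \<partial>lborel)"
      by (rule nn_integral_cmult) auto
    also have "\<dots> = ennreal (\<xi> ^ k / fact k) * ennreal (1 / (real k + 1/2))"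
      using nn_integral_powr_0_1[of "real k + 1/2 - 1"] by (simp add: add.commute)
    also have "\<dots> = ennreal (2 * (pochhammer (1/2) k * \<xi> ^ k / (pochhammer (3/2) k * fact k)))"
      unfolding eq[symmetric] using assms by (intro ennreal_mult[symmetric]) auto
    finally show "(\<integral>\<^sup>+s. ennreal (\<xi> ^ k / fact k) * ennreal (indicator {0<..1} s * s powr (real k + 1/2 - 1)) \<partial>lborel)
        = ennreal (2 * (pochhammer (1/2) k * \<xi> ^ k / (pochhammer (3/2) k * fact k)))" .
  qed
  also have "\<dots> = ennreal (2 * hypergeom_1F1 (1/2) (3/2) \<xi>)"
  proof -
    have "(\<lambda>k. 2 * (pochhammer (1/2) k * \<xi> ^ k / (pochhammer (3/2) k * fact k))) sums
        (2 * hypergeom_1F1 (1/2) (3/2) \<xi>)"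
      by (intro sums_mult hypergeom_1F1_sums) simp
    moreover have "0 \<le> pochhammer (1/2 :: real) k" "0 \<le> pochhammer (3/2 :: real) k" for k
      by (auto intro!: less_imp_le pochhammer_pos)
    ultimately show ?thesis
      using assms by (subst suminf_ennreal2) (auto simp: sums_iff)
  qed
  finally show ?thesis .
qed

text \<open>\<open>1 - exp (\<xi> - \<eta>)\<close> and \<open>\<eta> - \<xi>\<close> have the same
  sign, so the integrand is nonnegative and one computation in nonnegative integrals yields both
  integrability and the value.\<close>

lemma has_bochner_integral_exp_difference_quotient:
  assumes "0 < \<xi>"
  shows "has_bochner_integral lborel
    (\<lambda>\<eta>. indicator {0<..} \<eta> *\<^sub>R ((1 - exp (\<xi> - \<eta>)) / ((\<eta> - \<xi>) * sqrt \<eta>)))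
    (2 * sqrt pi * hypergeom_1F1 (1/2) (3/2) \<xi>)"
proof (rule has_bochner_integral_nn_integral)
  show "AE \<eta> in lborel. 0 \<le> indicator {0<..} \<eta> *\<^sub>R ((1 - exp (\<xi> - \<eta>)) / ((\<eta> - \<xi>) * sqrt \<eta>))"
    by (auto simp: indicator_def zero_le_divide_iff mult_le_0_iff zero_le_mult_iff)
  show "0 \<le> 2 * sqrt pi * hypergeom_1F1 (1/2) (3/2) \<xi>"
    unfolding hypergeom_1F1_def using assms
    by (auto intro!: mult_nonneg_nonneg suminf_nonneg summable_hypergeom_1F1 divide_nonneg_nonneg
        less_imp_le[OF pochhammer_pos])
  let ?h = "\<lambda>\<eta> s. ennreal (indicator {0<..} \<eta> * indicator {0<..1} s * (exp (- ((\<eta> - \<xi>) * s)) / sqrt \<eta>))"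
  have "(\<integral>\<^sup>+\<eta>. ennreal (indicator {0<..} \<eta> *\<^sub>R ((1 - exp (\<xi> - \<eta>)) / ((\<eta> - \<xi>) * sqrt \<eta>))) \<partial>lborel) =
      (\<integral>\<^sup>+\<eta>. (\<integral>\<^sup>+s. ?h \<eta> s \<partial>lborel) \<partial>lborel)"
  \<comment> \<open>The point \<open>\<eta> = \<xi>\<close> must be set aside: division by zero
    makes the quotient 0 there, whereas the inner integral is \<open>1 / sqrt \<xi>\<close>.\<close>
  proof (rule nn_integral_cong_AE, rule AE_mp[OF AE_lborel_singleton[of \<xi>]], intro AE_I2 impI)
    fix \<eta> :: real
    assume "\<eta> \<noteq> \<xi>"
    have "(\<integral>\<^sup>+s. ?h \<eta> s \<partial>lborel) = (\<integral>\<^sup>+s. ennreal (indicator {0<..} \<eta> / sqrt \<eta>) *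
        ennreal (indicator {0<..1} s * exp (- ((\<eta> - \<xi>) * s))) \<partial>lborel)"
      by (intro nn_integral_cong) (auto simp: indicator_def simp flip: ennreal_mult)
    also have "\<dots> = ennreal (indicator {0<..} \<eta> / sqrt \<eta>) * ennreal ((1 - exp (- (\<eta> - \<xi>))) / (\<eta> - \<xi>))"
      using \<open>\<eta> \<noteq> \<xi>\<close> by (subst nn_integral_cmult) (auto simp: nn_integral_exp_0_1)
    also have "\<dots> = ennreal (indicator {0<..} \<eta> / sqrt \<eta> * ((1 - exp (- (\<eta> - \<xi>))) / (\<eta> - \<xi>)))"
      by (intro ennreal_mult[symmetric]) (auto simp: indicator_def zero_le_divide_iff)
    finally show "ennreal (indicator {0<..} \<eta> *\<^sub>R ((1 - exp (\<xi> - \<eta>)) / ((\<eta> - \<xi>) * sqrt \<eta>))) = (\<integral>\<^sup>+s. ?h \<eta> s \<partial>lborel)"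
      by (simp add: mult.commute)
  qed
  \<comment> \<open>Tonelli: with \<open>\<eta>\<close> innermost, the integral is a Laplace
    transform of \<open>1 / sqrt \<eta>\<close> at \<open>s\<close>, times
    \<open>exp (\<xi> * s)\<close>.\<close>
  also have "\<dots> = (\<integral>\<^sup>+s. (\<integral>\<^sup>+\<eta>. ?h \<eta> s \<partial>lborel) \<partial>lborel)"
    by (rule lborel_pair.Fubini') (simp add: split_def)
  also have "\<dots> = (\<integral>\<^sup>+s. ennreal (sqrt pi) * ennreal (indicator {0<..1} s * (exp (\<xi> * s) / sqrt s)) \<partial>lborel)"
  proof (intro nn_integral_cong)
    fix s :: real
    show "(\<integral>\<^sup>+\<eta>. ?h \<eta> s \<partial>lborel) = ennreal (sqrt pi) * ennreal (indicator {0<..1} s * (exp (\<xi> * s) / sqrt s))"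
    proof (cases "s \<in> {0<..1}")
      case True
      have "(\<integral>\<^sup>+\<eta>. ?h \<eta> s \<partial>lborel) = (\<integral>\<^sup>+\<eta>. ennreal (exp (\<xi> * s)) *
          ennreal (indicator {0<..} \<eta> * (exp (- (\<eta> * s)) / sqrt \<eta>)) \<partial>lborel)"
        using True by (intro nn_integral_cong)
          (auto simp: indicator_def left_diff_distrib simp flip: ennreal_mult exp_add)
      also have "\<dots> = ennreal (exp (\<xi> * s)) * ennreal (sqrt pi / sqrt s)"
        using True by (subst nn_integral_cmult) (auto simp: nn_integral_exp_div_sqrt simp del: times_divide_eq_right)
      finally show ?thesis
        using True by (simp add: mult.commute flip: ennreal_mult)
    qed auto
  qed
  also have "\<dots> = ennreal (sqrt pi) * ennreal (2 * hypergeom_1F1 (1/2) (3/2) \<xi>)"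
    using assms by (subst nn_integral_cmult) (auto simp: nn_integral_exp_div_sqrt_0_1 simp del: times_divide_eq_right)
  also have "\<dots> = ennreal (2 * sqrt pi * hypergeom_1F1 (1/2) (3/2) \<xi>)"
    by (simp add: mult_ac flip: ennreal_mult')
  finally show "(\<integral>\<^sup>+\<eta>. ennreal (indicator {0<..} \<eta> *\<^sub>R ((1 - exp (\<xi> - \<eta>)) / ((\<eta> - \<xi>) * sqrt \<eta>))) \<partial>lborel) =
      ennreal (2 * sqrt pi * hypergeom_1F1 (1/2) (3/2) \<xi>)" .
qed measurable

text \<open>Writing \<open>exp (-\<eta>) = exp (-\<xi>) - exp (-\<xi>) * (1 - exp (\<xi> -
  \<eta>))\<close> separates a multiple of the bare kernel, with principal value 0, from an
  absolutely integrable remainder.\<close>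

lemma has_pv_integral_exp_inverse_sqrt:
  assumes "0 < \<xi>"
  shows "has_pv_integral (\<lambda>\<eta>. exp (-\<eta>) / ((\<eta> - \<xi>) * sqrt \<eta>)) {0<..} \<xi>
    (- (2 * sqrt pi * exp (-\<xi>) * hypergeom_1F1 (1/2) (3/2) \<xi>))"
proof -
  let ?q = "\<lambda>\<eta>. (1 - exp (\<xi> - \<eta>)) / ((\<eta> - \<xi>) * sqrt \<eta>)"
  have "set_integrable lborel {0<..} ?q"
    "set_lebesgue_integral lborel {0<..} ?q = 2 * sqrt pi * hypergeom_1F1 (1/2) (3/2) \<xi>"
    using has_bochner_integral_exp_difference_quotient[OF assms]
    by (auto simp: has_bochner_integral_iff set_integrable_def set_lebesgue_integral_def)
  then have "has_pv_integral ?q {0<..} \<xi> (2 * sqrt pi * hypergeom_1F1 (1/2) (3/2) \<xi>)"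
    using has_pv_integral_of_integrable[of "{0<..}" ?q \<xi>] by simp
  from has_pv_integral_add[OF has_pv_integral_cmult[OF has_pv_integral_inverse_sqrt_kernel[OF assms], of "exp (-\<xi>)"]
      has_pv_integral_cmult[OF this, of "- exp (-\<xi>)"]]
  have "has_pv_integral (\<lambda>\<eta>. exp (-\<xi>) * (1 / ((\<eta> - \<xi>) * sqrt \<eta>)) + - exp (-\<xi>) * ?q \<eta>) {0<..} \<xi>
    (- (2 * sqrt pi * exp (-\<xi>) * hypergeom_1F1 (1/2) (3/2) \<xi>))"
    by (simp add: mult_ac)
  moreover have "exp (-\<xi>) * (1 / ((\<eta> - \<xi>) * sqrt \<eta>)) + - exp (-\<xi>) * ?q \<eta> = exp (-\<eta>) / ((\<eta> - \<xi>) * sqrt \<eta>)" for \<eta>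
  proof -
    have "exp (-\<xi>) * exp (\<xi> - \<eta>) = exp (-\<eta>)"
      by (simp flip: exp_add)
    then show ?thesis
      by (simp add: right_diff_distrib diff_divide_distrib)
  qed
  ultimately show ?thesis
    by simp
qed

section \<open>Induction on the degree\<close>

text \<open>Since \<open>\<eta> / (\<eta> - \<xi>) = 1 + \<xi> / (\<eta> - \<xi>)\<close>, an extra
  factor \<open>\<eta>\<close> in the numerator multiplies the principal value by
  \<open>\<xi>\<close> and adds an ordinary integral.\<close>

lemma has_pv_integral_mult_variable:
  assumes "0 < \<xi>"
    and g: "has_pv_integral (\<lambda>\<eta>. g \<eta> / ((\<eta> - \<xi>) * sqrt \<eta>)) {0<..} \<xi> I"
    and int: "set_integrable lborel {0<..} (\<lambda>\<eta>. g \<eta> / sqrt \<eta>)"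
  shows "has_pv_integral (\<lambda>\<eta>. g \<eta> * sqrt \<eta> / (\<eta> - \<xi>)) {0<..} \<xi>
    (\<xi> * I + set_lebesgue_integral lborel {0<..} (\<lambda>\<eta>. g \<eta> / sqrt \<eta>))"
proof -
  have "has_pv_integral (\<lambda>\<eta>. \<xi> * (g \<eta> / ((\<eta> - \<xi>) * sqrt \<eta>)) + g \<eta> / sqrt \<eta>) {0<..} \<xi>
    (\<xi> * I + set_lebesgue_integral lborel {0<..} (\<lambda>\<eta>. g \<eta> / sqrt \<eta>))"
    by (intro has_pv_integral_add has_pv_integral_cmult g has_pv_integral_of_integrable int) auto
  moreover have "\<xi> * (g \<eta> / ((\<eta> - \<xi>) * sqrt \<eta>)) + g \<eta> / sqrt \<eta> = g \<eta> * sqrt \<eta> / (\<eta> - \<xi>)"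
    if "\<eta> \<in> {0<..}" "\<eta> \<noteq> \<xi>" for \<eta>
  proof -
    \<comment> \<open>In terms of \<open>y\<close> the identity is one between rational
      functions.\<close>
    define y where "y = sqrt \<eta>"
    have y: "y > 0" "\<eta> = y * y" "y * y \<noteq> \<xi>"
      using that by (auto simp: y_def)
    then show ?thesis
      unfolding y_def[symmetric] unfolding y(2) by (simp add: divide_simps) (simp add: algebra_simps)
  qed
  ultimately show ?thesis
    by (subst (asm) has_pv_integral_cong) auto
qed

text \<open>The two values are proved together: the first one in degree \<open>m + 1\<close> needs
  both in degree \<open>m\<close>, and the second one in degree \<open>m + 1\<close> needs the new
  first one and the old second one.\<close>

lemma has_pv_integral_laguerre:
  fixes m :: nat and \<xi> :: real
  assumes "0 < \<xi>"
  shows "has_pv_integral (\<lambda>\<eta>. exp (-\<eta>) * laguerre m (-1/2) \<eta> / ((\<eta> - \<xi>) * sqrt \<eta>)) {0<..} \<xi>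
      (sqrt pi * exp (-\<xi>) * (-2 * hypergeom_1F1 (1/2 - real m) (3/2) \<xi>)) \<and>
    has_pv_integral (\<lambda>\<eta>. exp (-\<eta>) * laguerre m (1/2) \<eta> * sqrt \<eta> / (\<eta> - \<xi>)) {0<..} \<xi>
      (sqrt pi * exp (-\<xi>) * hypergeom_1F1 (-1/2 - real m) (1/2) \<xi>)"
proof (induction m)
  case 0
  have "hypergeom_1F1 (-1/2) (1/2) \<xi> = exp \<xi> - 2 * \<xi> * hypergeom_1F1 (1/2) (3/2) \<xi>"
    using hypergeom_1F1_contiguous_upper[of "1/2" "1/2" \<xi>] hypergeom_1F1_same[of "1/2" \<xi>] by simp
  \<comment> \<open>The summand \<open>sqrt pi\<close> is the integral of the weight, that is, the
    case \<open>m = 0\<close> of the orthogonality lemma; it equals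
    \<open>sqrt pi * exp (-\<xi>) * exp \<xi>\<close>.\<close>
  then have "\<xi> * (sqrt pi * exp (-\<xi>) * (-2 * hypergeom_1F1 (1/2) (3/2) \<xi>)) + sqrt pi =
      sqrt pi * exp (-\<xi>) * hypergeom_1F1 (-1/2) (1/2) \<xi>"
    by (simp only:) (simp add: algebra_simps exp_minus)
  moreover have a: "has_pv_integral (\<lambda>\<eta>. exp (-\<eta>) / ((\<eta> - \<xi>) * sqrt \<eta>)) {0<..} \<xi>
      (sqrt pi * exp (-\<xi>) * (-2 * hypergeom_1F1 (1/2) (3/2) \<xi>))"
    using has_pv_integral_exp_inverse_sqrt[OF assms] by (simp add: mult_ac)
  ultimately have "has_pv_integral (\<lambda>\<eta>. exp (-\<eta>) * sqrt \<eta> / (\<eta> - \<xi>)) {0<..} \<xi>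
      (sqrt pi * exp (-\<xi>) * hypergeom_1F1 (-1/2) (1/2) \<xi>)"
    using has_pv_integral_mult_variable[OF assms a] laguerre_minus_half_orthogonal_1[of 0] by simp
  with a show ?case by simp
next
  case (Suc m)
  let ?K = "sqrt pi * exp (-\<xi>)"
  let ?a = "\<lambda>m. -2 * hypergeom_1F1 (1/2 - real m) (3/2) \<xi>"
  let ?b = "\<lambda>m. hypergeom_1F1 (-1/2 - real m) (1/2) \<xi>"
  let ?A = "\<lambda>m \<eta>. exp (-\<eta>) * laguerre m (-1/2) \<eta> / ((\<eta> - \<xi>) * sqrt \<eta>)"
  let ?B = "\<lambda>m \<eta>. exp (-\<eta>) * laguerre m (1/2) \<eta> * sqrt \<eta> / (\<eta> - \<xi>)"
  have rec: "(real m + 1/2) * laguerre m (-1/2) \<eta> - \<eta> * laguerre m (1/2) \<eta> =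
      (real m + 1) * laguerre (Suc m) (-1/2) \<eta>" for \<eta>
    using mult_laguerre[of \<eta> m "-1/2"] by simp
  \<comment> \<open>As \<open>sqrt \<eta> = \<eta> / sqrt \<eta>\<close>, the integrand
    \<open>?B m\<close> is of the same form as \<open>?A m\<close> with
    \<open>\<eta> * laguerre m (1/2) \<eta>\<close> as polynomial, so \<open>rec\<close>
    applies.\<close>
  have "(real m + 1/2) / (real m + 1) * ?A m \<eta> + - (1 / (real m + 1)) * ?B m \<eta> = ?A (Suc m) \<eta>"
    if "\<eta> \<in> {0<..}" for \<eta>
  proof -
    have "?B m \<eta> = exp (-\<eta>) * (\<eta> * laguerre m (1/2) \<eta>) / ((\<eta> - \<xi>) * sqrt \<eta>)"
      using that real_sqrt_mult_self[of \<eta>] by (simp add: divide_simps del: real_sqrt_mult_self)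
    then have "(real m + 1/2) / (real m + 1) * ?A m \<eta> + - (1 / (real m + 1)) * ?B m \<eta> =
      exp (-\<eta>) / ((\<eta> - \<xi>) * sqrt \<eta>) / (real m + 1) *
        ((real m + 1/2) * laguerre m (-1/2) \<eta> - \<eta> * laguerre m (1/2) \<eta>)"
      by (simp add: algebra_simps add_divide_distrib diff_divide_distrib)
    also have "\<dots> = ?A (Suc m) \<eta>"
      unfolding rec by simp
    finally show ?thesis .
  qed
  moreover have "(real m + 1/2) / (real m + 1) * (?K * ?a m) + - (1 / (real m + 1)) * (?K * ?b m) = ?K * ?a (Suc m)"
  proof -
    have "1/2 - real (Suc m) = -1/2 - real m"
      by simp
    \<comment> \<open>With \<open>c = 1/2\<close> and \<open>a = -1/2 - real m\<close> one has
      \<open>c - a = real m + 1\<close> and \<open>a = - (real m + 1/2)\<close>; the relation is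
      then multiplied by -2.\<close>
    then have rec_a: "(real m + 1) * ?a (Suc m) = (real m + 1/2) * ?a m - ?b m"
      using hypergeom_1F1_contiguous_lower[of "1/2" "-1/2 - real m" \<xi>] by (simp only:) (simp add: algebra_simps)
    have comb: "p / n * (K * a) + - (1 / n) * (K * b) = K * c"
      if "n * c = p * a - b" "n \<noteq> 0" for n p a b c K :: real
    proof -
      have "p / n * (K * a) + - (1 / n) * (K * b) = K * (p * a - b) / n"
        by (simp add: algebra_simps diff_divide_distrib)
      then show ?thesis
        unfolding that(1)[symmetric] using that(2) by simp
    qed
    show ?thesis
      by (rule comb[OF rec_a]) linarith
  qed
  moreover have "has_pv_integral (\<lambda>\<eta>. (real m + 1/2) / (real m + 1) * ?A m \<eta> + - (1 / (real m + 1)) * ?B m \<eta>) {0<..} \<xi>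
      ((real m + 1/2) / (real m + 1) * (?K * ?a m) + - (1 / (real m + 1)) * (?K * ?b m))"
    using Suc.IH by (intro has_pv_integral_add has_pv_integral_cmult) auto
  ultimately have A: "has_pv_integral (?A (Suc m)) {0<..} \<xi> (?K * ?a (Suc m))"
    by (subst (asm) has_pv_integral_cong) auto
  have "1/2 - real (Suc m) = -1/2 - real m"
    by simp
  then have "?b (Suc m) = ?b m + \<xi> * ?a (Suc m)"
    using hypergeom_1F1_contiguous_upper[of "1/2" "-1/2 - real m" \<xi>]
    by (simp only:) (simp add: algebra_simps)
  \<comment> \<open>The summand 0 stands for the integral of \<open>laguerre (Suc m) (-1/2)\<close>
    against the weight, which vanishes by orthogonality to constants.\<close>
  then have "?K * ?b m + (\<xi> * (?K * ?a (Suc m)) + 0) = ?K * ?b (Suc m)"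
    by (simp only:) (simp add: algebra_simps)
  moreover have "has_pv_integral (\<lambda>\<eta>. exp (-\<eta>) * laguerre (Suc m) (-1/2) \<eta> * sqrt \<eta> / (\<eta> - \<xi>)) {0<..} \<xi>
      (\<xi> * (?K * ?a (Suc m)) + 0)"
    using has_pv_integral_mult_variable[OF assms A] laguerre_minus_half_orthogonal_1[of "Suc m"] by simp
  from has_pv_integral_add[OF conjunct2[OF Suc.IH] this]
  have "has_pv_integral (\<lambda>\<eta>. ?B m \<eta> + exp (-\<eta>) * laguerre (Suc m) (-1/2) \<eta> * sqrt \<eta> / (\<eta> - \<xi>)) {0<..} \<xi>
      (?K * ?b m + (\<xi> * (?K * ?a (Suc m)) + 0))" .
  moreover have "?B m \<eta> + exp (-\<eta>) * laguerre (Suc m) (-1/2) \<eta> * sqrt \<eta> / (\<eta> - \<xi>) = ?B (Suc m) \<eta>" for \<eta>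
    using laguerre_Suc_upper[of m "-1/2" \<eta>] by (simp add: distrib_left distrib_right add_divide_distrib)
  ultimately have "has_pv_integral (?B (Suc m)) {0<..} \<xi> (?K * ?b (Suc m))"
    by (simp only:)
  with A show ?case by blast
qed

theorem corollary2p4:
  fixes m :: nat and \<xi> :: real
  assumes "0 < \<xi>"
  shows "pv_integrable (\<lambda>\<eta>. exp (-\<eta>) * laguerre m (-1/2) \<eta> / ((\<eta> - \<xi>) * sqrt \<eta>)) {0<..} \<xi> \<and>
         1 / pi * pv_integral (\<lambda>\<eta>. exp (-\<eta>) * laguerre m (-1/2) \<eta> / ((\<eta> - \<xi>) * sqrt \<eta>)) {0<..} \<xi>
           = - (2 * exp (-\<xi>) / sqrt pi) * hypergeom_1F1 (1/2 - real m) (3/2) \<xi> \<and>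
         pv_integrable (\<lambda>\<eta>. exp (-\<eta>) * laguerre m (1/2) \<eta> * sqrt \<eta> / (\<eta> - \<xi>)) {0<..} \<xi> \<and>
         1 / pi * pv_integral (\<lambda>\<eta>. exp (-\<eta>) * laguerre m (1/2) \<eta> * sqrt \<eta> / (\<eta> - \<xi>)) {0<..} \<xi>
           = exp (-\<xi>) / sqrt pi * hypergeom_1F1 (-1/2 - real m) (1/2) \<xi>"
proof -
  \<comment> \<open>The factor \<open>sqrt pi\<close> of the principal values turns the outer
    \<open>1 / pi\<close> into \<open>1 / sqrt pi\<close>.\<close>
  have scale: "1 / pi * (sqrt pi * x * y) = x / sqrt pi * y" for x y :: real
    using real_sqrt_mult_self[of pi] by (simp add: field_simps del: real_sqrt_mult_self)
  note pv = has_pv_integral_laguerre[OF assms, of m]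
  show ?thesis
    unfolding pv_integral_eqI[OF conjunct1[OF pv]] pv_integral_eqI[OF conjunct2[OF pv]] scale
    using pv by (auto simp: pv_integrable_def)
qed

end
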